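(* Let $n \geq 2$. The nested simple commutator equation $[x_1,x_2,\dots,x_n] = 1$ (in the $n$ free variables $x_1,\dots,x_n$) has finite satisfiability gap $\varepsilon = \frac{3}{2^{n+2}}$. That is, for every finite group $G$, either $\mathrm{ds}_G([x_1,\dots,x_n]=1) = 1$ or $\mathrm{ds}_G([x_1,\dots,x_n]=1) \leq 1 - \frac{3}{2^{n+2}}$.
   Context: For an equation $\varphi$ in the first-order language of group theory with $n$ free variables and a finite group $G$, the degree of satisfiability of $\varphi$ in $G$ is $\mathrm{ds}_G(\varphi) = \frac{|\{\overline{x} \in G^n : \varphi(\overline{x})\}|}{|G^n|}$. The equation $\varphi$ has finite satisfiability gap $\varepsilon > 0$ if for every finite group $G$ either $\mathrm{ds}_G(\varphi) = 1$ or $\mathrm{ds}_G(\varphi) \leq 1-\varepsilon$. The nested simple commutator is defined recursively by $[x_1,x_2] = x_1^{-1}x_2^{-1}x_1x_2$ and $[x_1,\dots,x_n] = [[x_1,\dots,x_{n-1}],x_n]$ for $n > 2$. *)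

theory Defs
  imports Complex_Main "HOL-Library.FuncSet" "HOL-Algebra.Group"
begin

datatype (term_vars: 'v) group_term =
    GVar 'v
  | GOne
  | GInv "'v group_term"
  | GMult "'v group_term" "'v group_term"

datatype 'v group_equation = GEq "'v group_term" "'v group_term"

primrec eqn_vars :: "'v group_equation \<Rightarrow> 'v set" where
  "eqn_vars (GEq s t) = term_vars s \<union> term_vars t"

primrec term_value :: "('a, 'b) monoid_scheme \<Rightarrow> ('v \<Rightarrow> 'a) \<Rightarrow> 'v group_term \<Rightarrow> 'a" where
  "term_value G x (GVar v) = x v"
| "term_value G x GOne = \<one>\<^bsub>G\<^esub>"
| "term_value G x (GInv t) = inv\<^bsub>G\<^esub> (term_value G x t)"
| "term_value G x (GMult s t) = term_value G x s \<otimes>\<^bsub>G\<^esub> term_value G x t"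

primrec satisfies :: "('a, 'b) monoid_scheme \<Rightarrow> ('v \<Rightarrow> 'a) \<Rightarrow> 'v group_equation \<Rightarrow> bool" where
  "satisfies G x (GEq s t) \<longleftrightarrow> term_value G x s = term_value G x t"

text \<open>For an equation with \<open>n\<close> free variables, the extensional functions from its set of
  variables to the carrier play the role of the tuples in \<open>G\<^sup>n\<close>.\<close>

definition assignments :: "('a, 'b) monoid_scheme \<Rightarrow> 'v group_equation \<Rightarrow> ('v \<Rightarrow> 'a) set" where
  "assignments G \<phi> = (eqn_vars \<phi> \<rightarrow>\<^sub>E carrier G)"

definition ds :: "('a, 'b) monoid_scheme \<Rightarrow> 'v group_equation \<Rightarrow> real" where
  "ds G \<phi> = real (card {x \<in> assignments G \<phi>. satisfies G x \<phi>}) / real (card (assignments G \<phi>))"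

text \<open>HOL cannot quantify over types inside a formula, so the element type of the groups is a
  parameter. The gap for all finite groups is the statement for a type variable \<open>'a\<close>.\<close>

definition finite_satisfiability_gap :: "'a itself \<Rightarrow> 'v group_equation \<Rightarrow> real \<Rightarrow> bool" where
  "finite_satisfiability_gap (_ :: 'a itself) \<phi> \<epsilon> \<longleftrightarrow>
     \<epsilon> > 0 \<and>
     (\<forall>G :: 'a monoid. group G \<and> finite (carrier G) \<longrightarrow> ds G \<phi> = 1 \<or> ds G \<phi> \<le> 1 - \<epsilon>)"

definition commutator_term :: "'v group_term \<Rightarrow> 'v group_term \<Rightarrow> 'v group_term" where
  "commutator_term s t = GMult (GMult (GMult (GInv s) (GInv t)) s) t"

text \<open>The term \<open>[x\<^sub>1, \<dots>, x\<^sub>n]\<close>, where \<open>x\<^sub>i\<close> is \<open>GVar i\<close>. The notion is meant for \<open>n \<ge> 2\<close>;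
  the convention \<open>[x\<^sub>1] = x\<^sub>1\<close> makes the recursion start at \<open>[x\<^sub>1, x\<^sub>2]\<close>, and the value
  at \<open>0\<close> is arbitrary.\<close>

fun nested_commutator :: "nat \<Rightarrow> nat group_term" where
  "nested_commutator 0 = GOne"
| "nested_commutator (Suc 0) = GVar 1"
| "nested_commutator (Suc (Suc n)) =
     commutator_term (nested_commutator (Suc n)) (GVar (Suc (Suc n)))"

definition nested_commutator_eqn :: "nat \<Rightarrow> nat group_equation" where
  "nested_commutator_eqn n = GEq (nested_commutator n) GOne"

lemma term_vars_nested_commutator: "term_vars (nested_commutator n) = {1..n}"
  by (induction n rule: nested_commutator.induct) (auto simp: commutator_term_def)

lemma eqn_vars_nested_commutator_eqn: "eqn_vars (nested_commutator_eqn n) = {1..n}"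
  by (simp add: nested_commutator_eqn_def term_vars_nested_commutator)

lemma nested_commutator_2: "nested_commutator 2 = commutator_term (GVar 1) (GVar 2)"
  by (simp add: numeral_2_eq_2)

lemma nested_commutator_step:
  "n > 2 \<Longrightarrow> nested_commutator n = commutator_term (nested_commutator (n - 1)) (GVar n)"
  by (cases n rule: nested_commutator.cases) auto

end

theory Submission
  imports Defs "HOL-Algebra.Coset"
begin

text \<open>
  The stronger gap \<open>1 / 2\<^sup>n\<close> holds: if \<open>[x\<^sub>1, \<dots>, x\<^sub>n] = 1\<close> is not a law of \<open>G\<close>, then at least
  a fraction \<open>1 / 2\<^sup>n\<close> of the tuples violates it, and \<open>3 / 2\<^bsup>n+2\<^esup> < 1 / 2\<^sup>n\<close>.

  Choose the entries one at a time. If \<open>w = [x\<^sub>1, \<dots>, x\<^sub>n]\<close> is not central, then the \<open>y\<close> with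
  \<open>[w, y] = 1\<close> form the centralizer of \<open>w\<close>, a proper subgroup, so at least half of all \<open>y\<close> give
  \<open>[w, y] \<noteq> 1\<close>. Hence each additional entry costs at most a factor 2, provided that the question
  \<open>[x\<^sub>1, \<dots>, x\<^sub>n] \<noteq> 1\<close> is asked in \<open>G / Z(G)\<close>. The recursion therefore climbs the upper central
  series. In order to stay in a single group, the induction is carried out for the condition
  \<open>[x\<^sub>1, \<dots>, x\<^sub>n] \<notin> N\<close> with an arbitrary normal subgroup \<open>N\<close>; its step replaces \<open>N\<close> by the
  preimage of the centre of \<open>G / N\<close>. This is \<open>nested_commutator_notin_normal_count\<close>, and the
  theorem is the case \<open>N = {1}\<close>.
\<close>

text \<open>By Lagrange, the index of a proper subgroup is at least 2.\<close>

lemma (in group) card_le_twice_card_diff_proper_subgroup: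
  assumes fin: "finite (carrier G)" and H: "subgroup H G" and ne: "H \<noteq> carrier G"
  shows "card (carrier G) \<le> 2 * card (carrier G - H)"
proof -
  have sub: "H \<subseteq> carrier G" using H by (rule subgroup.subset)
  have finH: "finite H" using sub fin by (rule finite_subset)
  have lt: "card H < card (carrier G)" using sub ne fin by (simp add: psubset_card_mono psubsetI)
  have "card (rcosets H) * card H = card (carrier G)"
    using lagrange[OF H] by (simp add: order_def)
  then obtain k where k: "card (carrier G) = k * card H" by metis
  then have "k \<noteq> 0" "k \<noteq> 1" using lt by auto
  then have "2 \<le> k" by simp
  then have "2 * card H \<le> card (carrier G)" unfolding k by (rule mult_le_mono1)
  moreover have "card (carrier G - H) = card (carrier G) - card H"
    by (rule card_Diff_subset[OF finH sub])
  ultimately show ?thesis by linarith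
qed

text \<open>
  With \<open>h\<close> the projection onto \<open>G / N\<close>, the next three lemmas describe commutators that fall into
  \<open>N\<close>: for fixed \<open>a\<close>, the \<open>x\<close> with \<open>[a, x] \<in> N\<close> form the preimage of the centralizer of \<open>h a\<close>,
  and the \<open>a\<close> for which this is all of \<open>G\<close> form the preimage of the centre.
\<close>

lemma (in group_hom) commutator_in_kernel_iff:
  assumes a: "a \<in> carrier G" and x: "x \<in> carrier G"
  shows "h (inv a \<otimes> inv x \<otimes> a \<otimes> x) = \<one>\<^bsub>H\<^esub> \<longleftrightarrow> h a \<otimes>\<^bsub>H\<^esub> h x = h x \<otimes>\<^bsub>H\<^esub> h a"
proof -
  have "inv a \<otimes> inv x \<otimes> a \<otimes> x = inv (x \<otimes> a) \<otimes> (a \<otimes> x)"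
    using a x by (simp add: G.inv_mult_group G.m_assoc)
  then have "h (inv a \<otimes> inv x \<otimes> a \<otimes> x) = inv\<^bsub>H\<^esub> (h x \<otimes>\<^bsub>H\<^esub> h a) \<otimes>\<^bsub>H\<^esub> (h a \<otimes>\<^bsub>H\<^esub> h x)"
    using a x by (simp add: H.inv_mult_group)
  moreover have "inv\<^bsub>H\<^esub> u \<otimes>\<^bsub>H\<^esub> v = \<one>\<^bsub>H\<^esub> \<longleftrightarrow> v = u" if "u \<in> carrier H" "v \<in> carrier H" for u v
    using H.inv_solve_left[of "\<one>\<^bsub>H\<^esub>" u v] that by auto
  ultimately show ?thesis using a x by (simp only: H.m_closed hom_closed)
qed

lemma (in group_hom) subgroup_commuting_image:
  assumes a: "a \<in> carrier G"
  shows "subgroup {x \<in> carrier G. h a \<otimes>\<^bsub>H\<^esub> h x = h x \<otimes>\<^bsub>H\<^esub> h a} G"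
proof (rule G.subgroupI)
  fix x assume "x \<in> {x \<in> carrier G. h a \<otimes>\<^bsub>H\<^esub> h x = h x \<otimes>\<^bsub>H\<^esub> h a}"
  then have x: "x \<in> carrier G" and eq: "h a \<otimes>\<^bsub>H\<^esub> h x = h x \<otimes>\<^bsub>H\<^esub> h a" by auto
  have "h a \<otimes>\<^bsub>H\<^esub> inv\<^bsub>H\<^esub> (h x) = inv\<^bsub>H\<^esub> (h x) \<otimes>\<^bsub>H\<^esub> h a"
    using a x eq by (metis H.inv_closed H.inv_solve_left H.inv_solve_right H.m_assoc H.m_closed hom_closed)
  then show "inv x \<in> {x \<in> carrier G. h a \<otimes>\<^bsub>H\<^esub> h x = h x \<otimes>\<^bsub>H\<^esub> h a}"
    using x by simp
next
  fix x y
  assume "x \<in> {x \<in> carrier G. h a \<otimes>\<^bsub>H\<^esub> h x = h x \<otimes>\<^bsub>H\<^esub> h a}"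
    and "y \<in> {x \<in> carrier G. h a \<otimes>\<^bsub>H\<^esub> h x = h x \<otimes>\<^bsub>H\<^esub> h a}"
  then show "x \<otimes> y \<in> {x \<in> carrier G. h a \<otimes>\<^bsub>H\<^esub> h x = h x \<otimes>\<^bsub>H\<^esub> h a}"
    using a by simp (metis H.m_assoc hom_closed)
qed (use a in auto)

text \<open>
  Conjugating an element of this set does not change its image under \<open>h\<close>, which gives normality;
  as an intersection of the subgroups of the previous lemma it is a subgroup.
\<close>

lemma (in group_hom) normal_preimage_center:
  "{a \<in> carrier G. \<forall>x\<in>carrier G. h a \<otimes>\<^bsub>H\<^esub> h x = h x \<otimes>\<^bsub>H\<^esub> h a} \<lhd> G" (is "?Z \<lhd> G")
  unfolding G.normal_inv_iff
proof (intro conjI ballI)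
  let ?C = "\<lambda>x. {a \<in> carrier G. h x \<otimes>\<^bsub>H\<^esub> h a = h a \<otimes>\<^bsub>H\<^esub> h x}"
  have "?Z \<subseteq> (\<Inter>x\<in>carrier G. ?C x)" by clarsimp
  moreover have "(\<Inter>x\<in>carrier G. ?C x) \<subseteq> ?C \<one>" by (rule INT_lower) simp
  then have "(\<Inter>x\<in>carrier G. ?C x) \<subseteq> ?Z" by fastforce
  ultimately have "?Z = (\<Inter>x\<in>carrier G. ?C x)" by (rule subset_antisym)
  moreover have "subgroup \<dots> G"
    by (rule G.subgroups_Inter) (auto intro: subgroup_commuting_image)
  ultimately show "subgroup ?Z G" by simp
next
  fix k a assume k: "k \<in> carrier G" and "a \<in> ?Z"
  then have a: "a \<in> carrier G" and comm: "\<And>x. x \<in> carrier G \<Longrightarrow> h a \<otimes>\<^bsub>H\<^esub> h x = h x \<otimes>\<^bsub>H\<^esub> h a"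
    by auto
  have "h (k \<otimes> a \<otimes> inv k) = h a"
    using k a by (simp add: comm[symmetric] H.m_assoc)
  then show "k \<otimes> a \<otimes> inv k \<in> ?Z"
    using k a comm by simp
qed

lemma (in group) term_value_closed:
  assumes "x \<in> term_vars t \<rightarrow> carrier G"
  shows "term_value G x t \<in> carrier G"
  using assms by (induction t) (auto simp: Pi_iff)

lemma term_value_cong:
  assumes "\<And>v. v \<in> term_vars t \<Longrightarrow> x v = y v"
  shows "term_value G x t = term_value G y t"
  using assms by (induction t) auto

text \<open>
  For one entry, \<open>N\<close> is a proper subgroup and so misses half of \<open>G\<close>. For the step, let \<open>Z / N\<close> be
  the centre of \<open>G / N\<close>. A witness for \<open>N\<close> and \<open>n + 1\<close> restricts to a witness for \<open>Z\<close> and \<open>n\<close>,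
  so the induction hypothesis supplies many tuples with \<open>[x\<^sub>1, \<dots>, x\<^sub>n] \<notin> Z\<close>. Each of them has at
  least \<open>|G| / 2\<close> extensions with commutator outside \<open>N\<close>, and different extensions are
  different tuples.
\<close>

lemma (in group) nested_commutator_notin_normal_count:
  assumes fin: "finite (carrier G)" and "n \<ge> 1" and "N \<lhd> G"
    and "\<exists>x \<in> {1..n} \<rightarrow>\<^sub>E carrier G. term_value G x (nested_commutator n) \<notin> N"
  shows "card (carrier G) ^ n
    \<le> 2 ^ n * card {x \<in> {1..n} \<rightarrow>\<^sub>E carrier G. term_value G x (nested_commutator n) \<notin> N}"
  using assms(2-)
proof (induction n arbitrary: N rule: dec_induct)
  case base
  have "subgroup N G" using base by (simp add: normal_imp_subgroup)
  moreover have "N \<noteq> carrier G" using base by (auto simp: PiE_def Pi_def)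
  ultimately have le: "card (carrier G) \<le> 2 * card (carrier G - N)"
    using fin by (intro card_le_twice_card_diff_proper_subgroup)
  have "(\<lambda>a. \<lambda>i\<in>{1..1::nat}. a) ` (carrier G - N)
      \<subseteq> {x \<in> {1..1} \<rightarrow>\<^sub>E carrier G. term_value G x (nested_commutator 1) \<notin> N}" (is "?f ` _ \<subseteq> ?B")
    by (auto simp: PiE_iff)
  moreover have "inj_on ?f (carrier G - N)"
    by (rule inj_onI) (metis atLeastAtMost_iff order_refl restrict_apply)
  moreover have "finite ?B" using fin by (simp add: finite_PiE)
  ultimately have "card (carrier G - N) \<le> card ?B" by (rule_tac card_inj_on_le)
  then show ?case using le by simp
next
  case (step n)
  let ?C = "carrier G" and ?w = "\<lambda>n x. term_value G x (nested_commutator n)"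
  let ?h = "\<lambda>a. N #> a" and ?Q = "G Mod N"
  interpret N: normal N G by (rule step.prems)
  interpret \<pi>: group_hom G ?Q ?h
    by (simp add: group_hom_def group_hom_axioms_def N.r_coset_hom_Mod N.factorgroup_is_group is_group)
  define Z where "Z = {a \<in> ?C. \<forall>y\<in>?C. ?h a \<otimes>\<^bsub>?Q\<^esub> ?h y = ?h y \<otimes>\<^bsub>?Q\<^esub> ?h a}"
  have "Z \<lhd> G" unfolding Z_def by (rule \<pi>.normal_preimage_center)
  have in_N: "inv a \<otimes> inv y \<otimes> a \<otimes> y \<in> N \<longleftrightarrow> ?h a \<otimes>\<^bsub>?Q\<^esub> ?h y = ?h y \<otimes>\<^bsub>?Q\<^esub> ?h a"
    if "a \<in> ?C" "y \<in> ?C" for a y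
  proof -
    let ?c = "inv a \<otimes> inv y \<otimes> a \<otimes> y"
    have "?c \<in> ?C" using that by simp
    then have "?c \<in> N \<longleftrightarrow> ?h ?c = N"
      using N.subgroup_axioms by (metis coset_join1 coset_join2 N.subset)
    then show ?thesis using \<pi>.commutator_in_kernel_iff[OF that] by (simp add: FactGroup_def)
  qed
  have w_Suc: "?w (Suc n) x = inv (?w n x) \<otimes> inv (x (Suc n)) \<otimes> ?w n x \<otimes> x (Suc n)" for x
    using step.hyps by (cases n) (auto simp: commutator_term_def)
  have w_closed: "?w n x \<in> ?C" if "x \<in> {1..n} \<rightarrow> ?C" for x
    using that by (simp add: term_value_closed term_vars_nested_commutator)
  define B where "B = {x \<in> {1..n} \<rightarrow>\<^sub>E ?C. ?w n x \<notin> Z}"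
  define B' where "B' = {x \<in> {1..Suc n} \<rightarrow>\<^sub>E ?C. ?w (Suc n) x \<notin> N}"
  \<comment> \<open>For \<open>x \<in> B\<close>, the set \<open>S x\<close> consists of the \<open>y\<close> with \<open>[x\<^sub>1, \<dots>, x\<^sub>n, y] \<notin> N\<close>.\<close>
  define S where "S x = ?C - {y \<in> ?C. ?h (?w n x) \<otimes>\<^bsub>?Q\<^esub> ?h y = ?h y \<otimes>\<^bsub>?Q\<^esub> ?h (?w n x)}" for x
  have finB: "finite B" "finite B'" using fin by (simp_all add: B_def B'_def finite_PiE)
  have "\<exists>x \<in> {1..n} \<rightarrow>\<^sub>E ?C. ?w n x \<notin> Z"
  proof -
    obtain x where x: "x \<in> {1..Suc n} \<rightarrow>\<^sub>E ?C" "?w (Suc n) x \<notin> N" using step.prems by blast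
    let ?x = "restrict x {1..n}"
    have mem: "?x \<in> {1..n} \<rightarrow>\<^sub>E ?C" "x (Suc n) \<in> ?C" "x \<in> {1..n} \<rightarrow> ?C" using x by auto
    have "?w n ?x = ?w n x" by (rule term_value_cong) (simp add: term_vars_nested_commutator)
    moreover have "?w n x \<notin> Z"
      using x(2) mem w_closed[OF mem(3)] unfolding w_Suc Z_def by (auto simp: in_N)
    ultimately show ?thesis using mem(1) by (intro bexI[of _ ?x]) auto
  qed
  then have IH: "card ?C ^ n \<le> 2 ^ n * card B"
    unfolding B_def by (rule step.IH[OF \<open>Z \<lhd> G\<close>])
  have half: "card ?C \<le> 2 * card (S x)" if "x \<in> B" for x
  proof -
    have a: "?w n x \<in> ?C" "?w n x \<notin> Z" using that w_closed[of x] by (auto simp: B_def)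
    then show ?thesis unfolding S_def
      by (intro card_le_twice_card_diff_proper_subgroup fin \<pi>.subgroup_commuting_image)
        (auto simp: Z_def)
  qed
  have "card (Sigma B S) \<le> card B'"
  proof (rule card_inj_on_le[where f = "\<lambda>(x, y). x(Suc n := y)"])
    show "inj_on (\<lambda>(x, y). x(Suc n := y)) (Sigma B S)"
    proof (rule inj_onI, clarify)
      fix x y x' y'
      assume "x \<in> B" "x' \<in> B" and eq: "x(Suc n := y) = x'(Suc n := y')"
      \<comment> \<open>Extensional tuples on \<open>{1..n}\<close> agree at \<open>n + 1\<close>, so the update loses no information.\<close>
      then have "x \<in> extensional {1..n}" "x' \<in> extensional {1..n}"
        by (simp_all add: B_def PiE_def)
      then have "x (Suc n) = x' (Suc n)" by (simp add: extensional_def)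
      then show "x = x' \<and> y = y'" using eq by (metis fun_upd_same fun_upd_triv fun_upd_upd)
    qed
    show "(\<lambda>(x, y). x(Suc n := y)) ` Sigma B S \<subseteq> B'"
    proof clarify
      fix x y assume x: "x \<in> B" and y: "y \<in> S x"
      have "?w n (x(Suc n := y)) = ?w n x"
        by (rule term_value_cong) (auto simp: term_vars_nested_commutator)
      moreover have "?w n x \<in> ?C" using x w_closed[of x] by (auto simp: B_def)
      ultimately have "?w (Suc n) (x(Suc n := y)) \<notin> N"
        using y unfolding w_Suc by (simp add: in_N S_def)
      moreover have "x(Suc n := y) \<in> {1..Suc n} \<rightarrow>\<^sub>E ?C"
        using x y by (auto simp: B_def S_def PiE_iff extensional_def le_Suc_eq)
      ultimately show "x(Suc n := y) \<in> B'" by (simp add: B'_def)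
    qed
  qed (rule finB)
  moreover have "card (Sigma B S) = (\<Sum>x\<in>B. card (S x))"
    using finB fin by (intro card_SigmaI) (auto simp: S_def)
  moreover have "card B * card ?C \<le> (\<Sum>x\<in>B. 2 * card (S x))"
    using sum_mono[of B "\<lambda>_. card ?C", OF half] by simp
  ultimately have "card B * card ?C \<le> 2 * card B'" by (simp flip: sum_distrib_left)
  then have double: "2 ^ n * (card B * card ?C) \<le> 2 ^ n * (2 * card B')" by (rule mult_le_mono2)
  have "card ?C ^ Suc n = card ?C ^ n * card ?C" by (rule power_Suc2)
  also have "\<dots> \<le> (2 ^ n * card B) * card ?C" using IH by (rule mult_le_mono1)
  also have "\<dots> = 2 ^ n * (card B * card ?C)" by (rule mult.assoc)
  also note double
  also have "2 ^ n * (2 * card B') = 2 ^ Suc n * card B'" by simp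
  finally have "card ?C ^ Suc n \<le> 2 ^ Suc n * card B'" .
  then show ?case by (simp only: B'_def)
qed

theorem corollary2p4:
  fixes n :: nat
  assumes "n \<ge> 2"
  shows "finite_satisfiability_gap TYPE('a) (nested_commutator_eqn n) (3 / 2 ^ (n + 2))"
  unfolding finite_satisfiability_gap_def
proof (intro conjI allI impI)
  show "3 / 2 ^ (n + 2) > (0 :: real)" by simp
next
  fix G :: "'a monoid"
  assume G: "group G \<and> finite (carrier G)"
  then interpret group G by simp
  have fin: "finite (carrier G)" using G by simp
  let ?w = "\<lambda>x. term_value G x (nested_commutator n)"
  define A where "A = ({1..n} \<rightarrow>\<^sub>E carrier G)"
  define B where "B = {x \<in> A. ?w x \<notin> {\<one>\<^bsub>G\<^esub>}}"
  have finA: "finite A" using fin by (simp add: A_def finite_PiE)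
  have cardA: "card A = card (carrier G) ^ n" by (simp add: A_def card_PiE)
  have "card (carrier G) > 0" using fin by (auto simp: card_gt_0_iff)
  then have posA: "card A > 0" by (simp add: cardA)
  have "card {x \<in> A. ?w x = \<one>\<^bsub>G\<^esub>} = card (A - B)" by (rule arg_cong[of _ _ card]) (auto simp: B_def)
  also have "\<dots> = card A - card B" using finA by (intro card_Diff_subset) (auto simp: B_def)
  finally have "real (card {x \<in> A. ?w x = \<one>\<^bsub>G\<^esub>}) = real (card A) - real (card B)"
    using card_mono[OF finA, of B] by (auto simp: B_def)
  then have ds: "ds G (nested_commutator_eqn n) = 1 - real (card B) / real (card A)"
    using posA unfolding ds_def assignments_def eqn_vars_nested_commutator_eqn A_def[symmetric]
    by (simp add: nested_commutator_eqn_def diff_divide_distrib)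
  show "ds G (nested_commutator_eqn n) = 1 \<or> ds G (nested_commutator_eqn n) \<le> 1 - 3 / 2 ^ (n + 2)"
  proof (cases "B = {}")
    case True
    then show ?thesis by (simp add: ds)
  next
    case False
    have "card A \<le> 2 ^ n * card B"
      unfolding cardA unfolding B_def A_def
      by (rule nested_commutator_notin_normal_count[OF fin])
        (use False assms in \<open>auto simp: B_def A_def one_is_normal\<close>)
    then have "real (card A) \<le> real (2 ^ n * card B)" by (rule of_nat_mono)
    then have "real (card A) \<le> 2 ^ n * real (card B)" by simp
    then have "1 / 2 ^ n \<le> real (card B) / real (card A)"
      using posA by (simp add: field_simps)
    moreover have "3 / 2 ^ (n + 2) \<le> (1 / 2 ^ n :: real)" by (simp add: field_simps)
    ultimately show ?thesis by (simp add: ds)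
  qed
qed

end
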